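(* Let $i\ge 1$ and $L\ge1$ be integers. (1) Let $a_i\ge 0$ be an integer, let $K=1+(i-1)L+a_i$, and let $R_1^*$ be the optimal transmission rate of the $\overline{(a_i,0,0,\dots,0)}_L$-ICP (the vector has $i$ entries, the last $i-1$ being $0$). Then $$R_1^*=K-(i-1)L+i-1\ \text{ units}.$$ (2) Let $a_1,\dots,a_i$ be non-negative integers, let $K=1+(i-1)+\sum_{j=1}^i a_j$, and let $R_2^*$ be the optimal transmission rate of the $\overline{(a_i,a_{i-1},\dots,a_1)}_1$-ICP. Then $$R_2^*=K\ \text{ units}.$$
   Context: Notation: $[n]=\{1,\dots,n\}$; $\langle m\rangle_n$ is the unique element of $[n]$ congruent to $m$ modulo $n$. Index coding problem (ICP): a server holds a finite collection of files, each of size 1 unit ($F$ bits, $F$ sufficiently large), mutually unrelated (arbitrary $F$-bit strings). There are $K$ users; user $k$ wants the set of files $\mathcal W_k$ and knows the set of files $\mathcal K_k$ (side-information), with $\mathcal K_k\cap\mathcal W_k=\emptyset$. The server broadcasts one message (a function of all the files) such that every user $k$ can recover all files in $\mathcal W_k$ from the message and the files in $\mathcal K_k$. The optimal transmission rate $R^*$ is the minimum (infimum) message size, in units of the file size, over all coding strategies (and $F$ large). The $\overline{(a_i,a_{i-1},\dots,a_1)}_L$-ICP: for non-negative integers $a_1,\dots,a_i$ and a positive integer $L$, put $K=1+(i-1)L+\sum_{j=1}^i a_j$. There are $K$ users and $iK$ files $x_{k,t}$, $k\in[K]$, $t\in[i]$. User $k\in[K]$ wants $\mathcal W_k=\{x_{k,1},\dots,x_{k,i}\}$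 and knows $$\mathcal K_k=\Big\{x_{b,t}: t\in[i],\,v\in[i-1],\,r\in[L],\ b=\Big\langle k+\sum_{j=1}^{v}a_{\langle i+t-j\rangle_i}+(v-1)L+r\Big\rangle_K\Big\}.$$ (That is, for each fixed $t$, going cyclically from $x_{k,t}$ one sees $a_{\langle t-1\rangle_i}$ unknown files, $L$ known files, $a_{\langle t-2\rangle_i}$ unknown files, $L$ known files, and so on, ending with $a_t$ unknown files.) *)

theory Defs
  imports Complex_Main "HOL-Library.FuncSet" "HOL-Number_Theory.Cong"
begin

definition cyc :: "nat \<Rightarrow> nat \<Rightarrow> nat"  (\<open>\<langle>_\<rangle>\<^sub>_\<close> [0, 1000] 1000)
  where "\<langle>m\<rangle>\<^sub>n = (if m mod n = 0 then n else m mod n)"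

lemma cyc_iff:
  assumes "n \<ge> 1"
  shows "c = \<langle>m\<rangle>\<^sub>n \<longleftrightarrow> c \<in> {1..n} \<and> [c = m] (mod n)"
proof
  assume "c = \<langle>m\<rangle>\<^sub>n"
  then show "c \<in> {1..n} \<and> [c = m] (mod n)"
    using assms mod_less_divisor[of n m] by (auto simp: cyc_def cong_def)
next
  assume *: "c \<in> {1..n} \<and> [c = m] (mod n)"
  show "c = \<langle>m\<rangle>\<^sub>n"
  proof (cases "c = n")
    case True
    with * show ?thesis by (auto simp: cyc_def cong_def)
  next
    case False
    with * show ?thesis by (auto simp: cyc_def cong_def)
  qed
qed


record ('u, 'f) icp =
  users :: "'u set"
  files :: "'f set"
  wants :: "'u \<Rightarrow> 'f set"
  knows :: "'u \<Rightarrow> 'f set"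

definition valid_icp :: "('u, 'f) icp \<Rightarrow> bool"
  where "valid_icp P \<longleftrightarrow> finite (users P) \<and> finite (files P) \<and>
    (\<forall>k\<in>users P. wants P k \<subseteq> files P \<and> knows P k \<subseteq> files P \<and> wants P k \<inter> knows P k = {})"

definition contents :: "('u, 'f) icp \<Rightarrow> nat \<Rightarrow> ('f \<Rightarrow> bool list) set"
  where "contents P F = files P \<rightarrow>\<^sub>E {w. length w = F}"

definition index_code ::
    "('u, 'f) icp \<Rightarrow> nat \<Rightarrow> nat \<Rightarrow> (('f \<Rightarrow> bool list) \<Rightarrow> bool list) \<Rightarrow>
     ('u \<Rightarrow> bool list \<Rightarrow> ('f \<Rightarrow> bool list) \<Rightarrow> 'f \<Rightarrow> bool list) \<Rightarrow> bool"
  where "index_code P F l enc dec \<longleftrightarrow>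
    (\<forall>x\<in>contents P F. length (enc x) = l \<and>
      (\<forall>k\<in>users P. \<forall>f\<in>wants P k. dec k (enc x) (restrict x (knows P k)) f = x f))"

text \<open>
  The infimum ranges over all file sizes \<open>F\<close>; by \<open>optimal_rate_large_files\<close> below,
  restricting it to arbitrarily large \<open>F\<close> gives the same value.
\<close>

definition optimal_rate :: "('u, 'f) icp \<Rightarrow> real"
  where "optimal_rate P =
    Inf {real l / real F | l F. F \<ge> 1 \<and> (\<exists>enc dec. index_code P F l enc dec)}"

lemma index_code_append:
  assumes P: "valid_icp P"
    and c1: "index_code P F1 l1 e1 d1" and c2: "index_code P F2 l2 e2 d2"
  shows "\<exists>e d. index_code P (F1 + F2) (l1 + l2) e d"
proof -
  define p where "p x = restrict (\<lambda>f. take F1 (x f)) (files P)" for x :: "'b \<Rightarrow> bool list"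
  define q where "q x = restrict (\<lambda>f. drop F1 (x f)) (files P)" for x :: "'b \<Rightarrow> bool list"
  define e where "e x = e1 (p x) @ e2 (q x)" for x
  define d where "d k M y f =
      d1 k (take l1 M) (restrict (\<lambda>f. take F1 (y f)) (knows P k)) f @
      d2 k (drop l1 M) (restrict (\<lambda>f. drop F1 (y f)) (knows P k)) f" for k M y f
  have "index_code P (F1 + F2) (l1 + l2) e d"
    unfolding index_code_def
  proof (intro ballI conjI)
    fix x assume x: "x \<in> contents P (F1 + F2)"
    have p: "p x \<in> contents P F1" and q: "q x \<in> contents P F2"
      using x by (auto simp: contents_def p_def q_def PiE_iff)
    have l: "length (e1 (p x)) = l1" "length (e2 (q x)) = l2"
      using c1 c2 p q by (auto simp: index_code_def)
    then show "length (e x) = l1 + l2" by (simp add: e_def)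
    fix k f assume k: "k \<in> users P" and f: "f \<in> wants P k"
    have s: "knows P k \<subseteq> files P" "f \<in> files P"
      using P k f by (auto simp: valid_icp_def)
    have rp: "restrict (\<lambda>f. take F1 (restrict x (knows P k) f)) (knows P k) = restrict (p x) (knows P k)"
      and rq: "restrict (\<lambda>f. drop F1 (restrict x (knows P k) f)) (knows P k) = restrict (q x) (knows P k)"
      using s by (auto simp: p_def q_def restrict_def fun_eq_iff)
    have "d1 k (e1 (p x)) (restrict (p x) (knows P k)) f = p x f"
      and "d2 k (e2 (q x)) (restrict (q x) (knows P k)) f = q x f"
      using c1 c2 p q k f unfolding index_code_def by blast+
    then show "d k (e x) (restrict x (knows P k)) f = x f"
      unfolding d_def rp rq using l s by (simp add: e_def p_def q_def)
  qed
  then show ?thesis by blast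
qed

lemma index_code_repeat:
  assumes "valid_icp P" and "index_code P F l enc dec"
  shows "\<exists>e d. index_code P (Suc m * F) (Suc m * l) e d"
proof (induction m)
  case 0
  then show ?case using assms by auto
next
  case (Suc m)
  then obtain e d where "index_code P (Suc m * F) (Suc m * l) e d" by blast
  from index_code_append[OF assms(1) assms(2) this] show ?case by simp
qed

lemma optimal_rate_large_files:
  assumes "valid_icp P"
  shows "optimal_rate P =
    Inf {real l / real F | l F. F \<ge> 1 \<and> F \<ge> F0 \<and> (\<exists>enc dec. index_code P F l enc dec)}"
proof -
  have *: "\<exists>l' F'. real l / real F = real l' / real F' \<and> F' \<ge> 1 \<and> F' \<ge> F0 \<and>
      (\<exists>enc dec. index_code P F' l' enc dec)"
    if "F \<ge> 1" "index_code P F l enc dec" for l F enc dec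
  proof -
    obtain e d where "index_code P (Suc F0 * F) (Suc F0 * l) e d"
      using index_code_repeat[OF assms \<open>index_code P F l enc dec\<close>] by blast
    moreover have "Suc F0 * 1 \<le> Suc F0 * F" using that by (intro mult_le_mono) auto
    moreover have "real l / real F = real (Suc F0 * l) / real (Suc F0 * F)"
      unfolding of_nat_mult by (rule mult_divide_mult_cancel_left[symmetric]) simp
    ultimately show ?thesis
      by (intro exI[of _ "Suc F0 * l"] exI[of _ "Suc F0 * F"]) auto
  qed
  have "{real l / real F | l F. F \<ge> 1 \<and> (\<exists>enc dec. index_code P F l enc dec)} =
      {real l / real F | l F. F \<ge> 1 \<and> F \<ge> F0 \<and> (\<exists>enc dec. index_code P F l enc dec)}"
    (is "?A = ?B")
  proof (intro equalityI subsetI)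
    fix y assume "y \<in> ?A"
    then obtain l F enc dec where y: "y = real l / real F" "F \<ge> 1" "index_code P F l enc dec"
      by blast
    from *[OF y(2,3)] show "y \<in> ?B" unfolding y(1) by blast
  next
    fix y assume "y \<in> ?B"
    then show "y \<in> ?A" by blast
  qed
  then show ?thesis by (simp add: optimal_rate_def)
qed


text \<open>
  The vector \<open>(a\<^sub>i, \<dots>, a\<^sub>1)\<close> is given as a function \<open>a\<close>, of which only the values at
  \<open>1, \<dots>, i\<close> matter. The file \<open>x\<^sub>k\<^sub>,\<^sub>t\<close> is the pair \<open>(k, t)\<close>.
\<close>

definition num_users :: "nat \<Rightarrow> nat \<Rightarrow> (nat \<Rightarrow> nat) \<Rightarrow> nat"
  where "num_users i L a = 1 + (i - 1) * L + (\<Sum>j=1..i. a j)"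

definition cyclic_icp :: "nat \<Rightarrow> nat \<Rightarrow> (nat \<Rightarrow> nat) \<Rightarrow> (nat, nat \<times> nat) icp"
  where "cyclic_icp i L a =
    (let K = num_users i L a in
      \<lparr> users = {1..K},
        files = {1..K} \<times> {1..i},
        wants = (\<lambda>k. {(k, t) | t. t \<in> {1..i}}),
        knows = (\<lambda>k. {(\<langle>k + (\<Sum>j=1..v. a (\<langle>i + t - j\<rangle>\<^sub>i)) + (v - 1) * L + r\<rangle>\<^sub>K, t) | t v r.
                   t \<in> {1..i} \<and> v \<in> {1..i - 1} \<and> r \<in> {1..L}}) \<rparr>)"

lemma cyc_range: "n \<ge> 1 \<Longrightarrow> \<langle>m\<rangle>\<^sub>n \<in> {1..n}"
  and cyc_cong: "n \<ge> 1 \<Longrightarrow> [\<langle>m\<rangle>\<^sub>n = m] (mod n)"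
  using cyc_iff[of n "\<langle>m\<rangle>\<^sub>n" m] by simp_all

lemma valid_cyclic_icp: "valid_icp (cyclic_icp i L a)"
proof -
  define K where "K = num_users i L a"
  have K: "K \<ge> 1" by (simp add: K_def num_users_def)
  have ne: "\<langle>k + (\<Sum>j=1..v. a (\<langle>i + t - j\<rangle>\<^sub>i)) + (v - 1) * L + r\<rangle>\<^sub>K \<noteq> k"
    if t: "t \<in> {1..i}" and v: "v \<in> {1..i - 1}" and r: "r \<in> {1..L}" for k t v r
  proof
    define s where "s = (\<Sum>j=1..v. a (\<langle>i + t - j\<rangle>\<^sub>i)) + (v - 1) * L + r"
    have i: "i \<ge> 1" using t by auto
    have inj: "inj_on (\<lambda>j. \<langle>i + t - j\<rangle>\<^sub>i) {1..v}"
    proof (rule inj_onI)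
      fix j j' assume j: "j \<in> {1..v}" "j' \<in> {1..v}" "\<langle>i + t - j\<rangle>\<^sub>i = \<langle>i + t - j'\<rangle>\<^sub>i"
      have "[i + t - j = i + t - j'] (mod i)"
        using cyc_cong[OF i, of "i + t - j"] cyc_cong[OF i, of "i + t - j'"] j(3)
        by (simp add: cong_def)
      then have "[int (i + t - j) = int (i + t - j')] (mod int i)"
        by (simp add: cong_int_iff)
      then have "[int i + int t - int j = int i + int t - int j'] (mod int i)"
        using j(1,2) v by (subst (asm) (1 2) of_nat_diff) auto
      then have "int i dvd int j' - int j" by (simp add: cong_iff_dvd_diff)
      then have "[int j' = int j] (mod int i)" by (simp add: cong_iff_dvd_diff)
      then have "[j = j'] (mod i)" by (simp add: cong_int_iff cong_sym_eq)
      then show "j = j'" using j v by (auto intro: cong_less_modulus_unique_nat)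
    qed
    have "(\<Sum>j=1..v. a (\<langle>i + t - j\<rangle>\<^sub>i)) = sum a ((\<lambda>j. \<langle>i + t - j\<rangle>\<^sub>i) ` {1..v})"
      by (simp only: sum.reindex[OF inj] o_def)
    also have "\<dots> \<le> (\<Sum>j=1..i. a j)"
    proof (rule sum_mono2)
      show "(\<lambda>j. \<langle>i + t - j\<rangle>\<^sub>i) ` {1..v} \<subseteq> {1..i}" using cyc_range[OF i] by (rule image_subsetI)
    qed simp_all
    finally have 1: "(\<Sum>j=1..v. a (\<langle>i + t - j\<rangle>\<^sub>i)) \<le> (\<Sum>j=1..i. a j)" .
    have "(v - 1) * L + r \<le> (v - 1) * L + L" using r by simp
    also have "\<dots> = v * L" using v by (cases v) auto
    also have "\<dots> \<le> (i - 1) * L" using v by (intro mult_le_mono1) auto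
    finally have "s < K" "s > 0" using 1 r by (auto simp: s_def K_def num_users_def)
    assume "\<langle>k + (\<Sum>j=1..v. a (\<langle>i + t - j\<rangle>\<^sub>i)) + (v - 1) * L + r\<rangle>\<^sub>K = k"
    then have "\<langle>k + s\<rangle>\<^sub>K = k" by (simp add: s_def add.assoc)
    then have "[k = k + s] (mod K)" using cyc_cong[OF K, of "k + s"] by simp
    then have "[int k = int k + int s] (mod int K)" by (metis cong_int_iff of_nat_add)
    then have "K dvd s" by (simp add: cong_iff_dvd_diff)
    with \<open>s < K\<close> \<open>s > 0\<close> show False by (simp add: nat_dvd_not_less)
  qed
  have "wants (cyclic_icp i L a) k \<subseteq> files (cyclic_icp i L a)"
    and "knows (cyclic_icp i L a) k \<subseteq> files (cyclic_icp i L a)"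
    and "wants (cyclic_icp i L a) k \<inter> knows (cyclic_icp i L a) k = {}"
    if "k \<in> users (cyclic_icp i L a)" for k
  proof -
    show "wants (cyclic_icp i L a) k \<subseteq> files (cyclic_icp i L a)"
      using that by (auto simp: cyclic_icp_def Let_def)
    show "knows (cyclic_icp i L a) k \<subseteq> files (cyclic_icp i L a)"
      using cyc_range[OF K] by (auto simp: cyclic_icp_def Let_def simp flip: K_def)
    show "wants (cyclic_icp i L a) k \<inter> knows (cyclic_icp i L a) k = {}"
    proof (rule equals0I)
      fix f assume "f \<in> wants (cyclic_icp i L a) k \<inter> knows (cyclic_icp i L a) k"
      then obtain t v r where "t \<in> {1..i}" "v \<in> {1..i - 1}" "r \<in> {1..L}"
        "k = \<langle>k + (\<Sum>j=1..v. a (\<langle>i + t - j\<rangle>\<^sub>i)) + (v - 1) * L + r\<rangle>\<^sub>K"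
        unfolding cyclic_icp_def Let_def K_def by (simp (no_asm_use)) blast
      with ne show False by metis
    qed
  qed
  moreover have "finite (users (cyclic_icp i L a))" "finite (files (cyclic_icp i L a))"
    by (simp_all add: cyclic_icp_def Let_def)
  ultimately show ?thesis by (simp add: valid_icp_def)
qed

end

theory Submission imports Defs begin

text \<open>
  Colour the file \<open>(b, t)\<close> with the residue of \<open>b - (\<Sum>j<t. a\<^sub>j + L)\<close> modulo \<open>K\<close>. For the upper
  bounds, read the files as integers and broadcast the first \<open>n\<close> power sums of the colours, weighted
  by the files. By Vandermonde, a user facing at most \<open>n\<close> colours among its unknown files learns the
  total of every colour class, and hence each of its wanted files, provided that no other unknown
  file has the same colour. The message exceeds the size of \<open>n\<close> files by a number of bits that does
  not depend on the file size, so no finite field is needed. For the lower bounds, a set of files that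
  the users can decode one after the other, given all other files, is determined by the message.
  In part (1) it consists of the files \<open>(1, t)\<close> and the files \<open>(b, 1)\<close> with \<open>b \<le> a\<^sub>i + 1\<close>, in part (2)
  of the file of the smallest user in each colour class.
\<close>

section \<open>Upper bound: codes from colourings of the files\<close>

text \<open>Injectivity of a Vandermonde system. Replacing the weights \<open>z c\<close> by
  \<open>z c * (x c - x d)\<close> kills the term of \<open>d\<close> at the cost of one equation,
  since the new power sums combine two consecutive old ones. This reduces \<open>insert d D\<close>
  to \<open>D\<close>.\<close>

lemma power_sums_zero_imp_zero:
  fixes z x :: "'a \<Rightarrow> 'b::idom"
  assumes "finite D" and "inj_on x D" and "card D \<le> n"
    and "\<And>j. j < n \<Longrightarrow> (\<Sum>c\<in>D. z c * x c ^ j) = 0" and "c \<in> D"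
  shows "z c = 0"
  using assms
proof (induction D arbitrary: n z c rule: finite_induct)
  case (insert d D)
  obtain m where m: "n = Suc m" "card D \<le> m"
    using insert.prems(2) insert.hyps by (cases n) auto
  have D0: "z c = 0" if "c \<in> D" for c
  proof -
    have "z c * (x c - x d) = 0"
    proof (rule insert.IH[OF _ m(2), of "\<lambda>c. z c * (x c - x d)"])
      fix j assume j: "j < m"
      have "(\<Sum>c\<in>D. z c * (x c - x d) * x c ^ j) = (\<Sum>c\<in>insert d D. z c * (x c - x d) * x c ^ j)"
        using insert.hyps by simp
      also have "\<dots> = (\<Sum>c\<in>insert d D. z c * x c ^ Suc j) - x d * (\<Sum>c\<in>insert d D. z c * x c ^ j)"
        unfolding sum_distrib_left sum_subtractf[symmetric]
        by (intro sum.cong) (auto simp: algebra_simps)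
      also have "\<dots> = 0"
        using insert.prems(3)[of j] insert.prems(3)[of "Suc j"] j m(1) by simp
      finally show "(\<Sum>c\<in>D. z c * (x c - x d) * x c ^ j) = 0" .
    qed (use insert.prems that in auto)
    moreover have "x c \<noteq> x d"
      using inj_onD[OF insert.prems(1), of c d] insert.hyps that by auto
    ultimately show ?thesis by simp
  qed
  have "z d = 0"
    using insert.prems(3)[of 0] insert.hyps D0 m by simp
  then show ?case using D0 insert.prems(4) by auto
qed simp

lemma finite_lists_length: "finite {w :: bool list. length w = l}"
  and card_lists_length: "card {w :: bool list. length w = l} = 2 ^ l"
  using finite_lists_length_eq[of "UNIV :: bool set" l] card_lists_length_eq[of "UNIV :: bool set" l]
  by simp_all

text \<open>Decoders need not be constructed: if message and side-information determine the wanted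
  files, a user may pick any contents consistent with both.\<close>

lemma index_code_exI:
  assumes "finite (contents P F)"
    and "\<And>x. x \<in> contents P F \<Longrightarrow> length (enc x) = l"
    and "\<And>x y k f. x \<in> contents P F \<Longrightarrow> y \<in> contents P F \<Longrightarrow> enc x = enc y \<Longrightarrow> k \<in> users P \<Longrightarrow>
      restrict x (knows P k) = restrict y (knows P k) \<Longrightarrow> f \<in> wants P k \<Longrightarrow> x f = y f"
  shows "\<exists>dec. index_code P F l enc dec"
proof -
  define dec where "dec k M s =
    (SOME y. y \<in> contents P F \<and> enc y = M \<and> restrict y (knows P k) = s)" for k M s
  have "dec k (enc x) (restrict x (knows P k)) f = x f"
    if "x \<in> contents P F" "k \<in> users P" "f \<in> wants P k" for x k f
  proof -
    let ?y = "dec k (enc x) (restrict x (knows P k))"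
    have "?y \<in> contents P F \<and> enc ?y = enc x \<and> restrict ?y (knows P k) = restrict x (knows P k)"
      unfolding dec_def by (rule someI[of _ x]) (use that in auto)
    then show ?thesis using assms(3) that by metis
  qed
  then have "index_code P F l enc dec"
    using assms(2) by (auto simp: index_code_def)
  then show ?thesis by blast
qed

lemma finite_contents: "valid_icp P \<Longrightarrow> finite (contents P F)"
  by (auto simp: contents_def valid_icp_def intro!: finite_PiE finite_lists_length)

text \<open>The constant \<open>c\<close> is chosen before \<open>F\<close>, so the overhead per
  file bit vanishes as \<open>F\<close> grows.\<close>

lemma index_code_of_colouring:
  fixes P :: "('u, 'f) icp" and col :: "'f \<Rightarrow> nat"
  assumes P: "valid_icp P"
    and card: "\<And>k. k \<in> users P \<Longrightarrow> card (col ` (files P - knows P k)) \<le> n"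
    and uniq: "\<And>k f g. k \<in> users P \<Longrightarrow> f \<in> wants P k \<Longrightarrow> g \<in> files P \<Longrightarrow> g \<notin> knows P k \<Longrightarrow>
      col g = col f \<Longrightarrow> g = f"
  shows "\<exists>c. \<forall>F. \<exists>enc dec. index_code P F (n * (F + c)) enc dec"
proof -
  \<comment> \<open>Dominates the total weight of each of the \<open>n\<close> power sums. Since
    file values are at most \<open>2 ^ F\<close> and \<open>c < 2 ^ c\<close>, every power sum lies
    below \<open>2 ^ (F + c)\<close>.\<close>
  define c where "c = (\<Sum>j<n. \<Sum>f\<in>files P. col f ^ j)"
  have "\<exists>enc dec. index_code P F (n * (F + c)) enc dec" for F
  proof -
    have fin: "finite (files P)" using P by (simp add: valid_icp_def)
    obtain val :: "bool list \<Rightarrow> nat" where val: "bij_betw val {w. length w = F} {0..<2 ^ F}"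
      using ex_bij_betw_finite_nat[OF finite_lists_length[of F]] card_lists_length[of F] by auto
    define M where "M x = (\<lambda>j\<in>{..<n}. \<Sum>f\<in>files P. col f ^ j * val (x f))" for x
    have val_le: "val w \<le> 2 ^ F" if "length w = F" for w
      using bij_betwE[OF val] that by fastforce
    have "(\<Sum>f\<in>files P. col f ^ j * val (x f)) < 2 ^ (F + c)"
      if "x \<in> contents P F" "j < n" for x j
    proof -
      have "(\<Sum>f\<in>files P. col f ^ j * val (x f)) \<le> (\<Sum>f\<in>files P. col f ^ j) * 2 ^ F"
        unfolding sum_distrib_right using that val_le
        by (intro sum_mono mult_le_mono2) (auto simp: contents_def)
      also have "\<dots> \<le> c * 2 ^ F"
        unfolding c_def using that
        by (intro mult_le_mono1 member_le_sum[where f = "\<lambda>j. \<Sum>f\<in>files P. col f ^ j"]) auto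
      also have "\<dots> < 2 ^ c * 2 ^ F" by (intro mult_strict_right_mono less_exp) simp
      finally show ?thesis by (simp add: power_add mult.commute)
    qed
    then have M_in: "M x \<in> {..<n} \<rightarrow>\<^sub>E {..<2 ^ (F + c)}" if "x \<in> contents P F" for x
      using that by (auto simp: M_def)
    have "card ({..<n} \<rightarrow>\<^sub>E {..<2 ^ (F + c) :: nat}) = card {w :: bool list. length w = n * (F + c)}"
      by (simp add: card_PiE card_lists_length power_mult[symmetric] mult.commute)
    \<comment> \<open>Only the count matters: \<open>n\<close> numbers below
      \<open>2 ^ (F + c)\<close> have exactly as many possibilities as a message of
      \<open>n * (F + c)\<close> bits.\<close>
    then obtain bits :: "(nat \<Rightarrow> nat) \<Rightarrow> bool list"
      where bits: "bij_betw bits ({..<n} \<rightarrow>\<^sub>E {..<2 ^ (F + c)}) {w. length w = n * (F + c)}"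
      using finite_same_card_bij[OF _ finite_lists_length] by (metis finite_PiE finite_lessThan)
    have "\<exists>dec. index_code P F (n * (F + c)) (bits \<circ> M) dec"
    proof (rule index_code_exI[OF finite_contents[OF P]])
      show "length ((bits \<circ> M) x) = n * (F + c)" if "x \<in> contents P F" for x
        using bij_betwE[OF bits] M_in[OF that] by auto
    next
      fix x y k f
      assume x: "x \<in> contents P F" and y: "y \<in> contents P F"
        and enc: "(bits \<circ> M) x = (bits \<circ> M) y" and k: "k \<in> users P"
        and side: "restrict x (knows P k) = restrict y (knows P k)" and f: "f \<in> wants P k"
      let ?U = "files P - knows P k"
      have M: "M x = M y"
        using enc bits M_in[OF x] M_in[OF y] by (auto simp: bij_betw_def dest: inj_onD)
      define d where "d g = int (val (x g)) - int (val (y g))" for g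
      have d0: "d g = 0" if "g \<in> knows P k" for g
        using fun_cong[OF side, of g] that by (simp add: d_def)
      have fU: "f \<in> ?U" using P k f by (auto simp: valid_icp_def)
      \<comment> \<open>Two contents with equal message and equal side-information are compared
        through \<open>d\<close>. The class totals of \<open>d\<close> over the unknown files are
        the unknowns of the Vandermonde system.\<close>
      define z where "z c = (\<Sum>g\<in>{g \<in> ?U. col g = c}. d g)" for c
      have "z (col f) = 0"
      proof (rule power_sums_zero_imp_zero[where D = "col ` ?U" and x = int and n = n])
        fix j assume j: "j < n"
        have "(\<Sum>c\<in>col ` ?U. z c * int c ^ j) =
            (\<Sum>c\<in>col ` ?U. \<Sum>g\<in>{g \<in> ?U. col g = c}. d g * int (col g) ^ j)"
          by (simp add: z_def sum_distrib_right)
        also have "\<dots> = (\<Sum>g\<in>?U. d g * int (col g) ^ j)"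
          using fin by (intro sum.image_gen[symmetric]) simp
        \<comment> \<open>Known files contribute nothing because \<open>d\<close> vanishes on them,
          so the sum becomes a difference of broadcast values.\<close>
        also have "\<dots> = (\<Sum>g\<in>files P. d g * int (col g) ^ j)"
          using fin d0 by (intro sum.mono_neutral_left) auto
        also have "\<dots> = int (M x j) - int (M y j)"
        proof -
          have "int (M x j) = (\<Sum>g\<in>files P. int (val (x g)) * int (col g) ^ j)" for x
            using j by (simp add: M_def mult.commute)
          then show ?thesis by (simp only: d_def left_diff_distrib sum_subtractf)
        qed
        finally show "(\<Sum>c\<in>col ` ?U. z c * int c ^ j) = 0"
          using M by simp
      qed (use fin card[OF k] fU in auto)
      moreover have "{g \<in> ?U. col g = col f} = {f}"
        using uniq[OF k f] fU by auto
      ultimately have "val (x f) = val (y f)" by (simp add: z_def d_def)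
      moreover have "length (x f) = F" "length (y f) = F"
        using x y fU by (auto simp: contents_def)
      ultimately show "x f = y f"
        using val by (auto simp: bij_betw_def dest: inj_onD)
    qed
    then show ?thesis by blast
  qed
  then show ?thesis by blast
qed

section \<open>Lower bound, and the rate when both bounds meet\<close>

text \<open>The rank \<open>r\<close> gives the decoding order: what the user \<open>u f\<close>
  knows inside \<open>S\<close> has smaller rank and is already decoded. Hence the encoder is
  injective on the contents of \<open>S\<close>, and counting yields the bound.\<close>

lemma card_le_of_index_code:
  fixes r :: "'f \<Rightarrow> nat"
  assumes P: "valid_icp P" and code: "index_code P F l enc dec" and S: "S \<subseteq> files P"
    and u: "\<And>f. f \<in> S \<Longrightarrow> u f \<in> users P \<and> f \<in> wants P (u f)"
    and r: "\<And>f g. f \<in> S \<Longrightarrow> g \<in> S \<Longrightarrow> g \<in> knows P (u f) \<Longrightarrow> r g < r f"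
  shows "card S * F \<le> l"
proof -
  \<comment> \<open>Files outside \<open>S\<close> are frozen to zeros, so they agree in any two
    compared contents.\<close>
  define ext where "ext s = (\<lambda>f\<in>files P. if f \<in> S then s f else replicate F False)"
    for s :: "'f \<Rightarrow> bool list"
  let ?X = "S \<rightarrow>\<^sub>E {w :: bool list. length w = F}"
  have fin: "finite (files P)" "finite S"
    using P S by (auto simp: valid_icp_def dest: finite_subset)
  have ext: "ext s \<in> contents P F" if "s \<in> ?X" for s
    using that by (auto simp: ext_def contents_def)
  have "inj_on (enc \<circ> ext) ?X"
  proof (rule inj_onI)
    fix s s' assume s: "s \<in> ?X" "s' \<in> ?X" and eq: "(enc \<circ> ext) s = (enc \<circ> ext) s'"
    have "s f = s' f" if "f \<in> S" for f
      using that
    proof (induction "r f" arbitrary: f rule: less_induct)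
      case less
      have "restrict (ext s) (knows P (u f)) = restrict (ext s') (knows P (u f))"
      proof
        fix g
        show "restrict (ext s) (knows P (u f)) g = restrict (ext s') (knows P (u f)) g"
          using less.hyps[of g] r[OF less.prems, of g] by (auto simp: ext_def restrict_def)
      qed
      moreover have "dec (u f) (enc (ext t)) (restrict (ext t) (knows P (u f))) f = ext t f"
        if "t \<in> ?X" for t
        using code ext[OF that] u[OF less.prems] by (auto simp: index_code_def)
      ultimately have "ext s f = ext s' f"
        using s eq by (metis comp_apply)
      then show ?case using less.prems S by (auto simp: ext_def)
    qed
    then show "s = s'" using s by (auto intro: PiE_ext)
  qed
  moreover have "(enc \<circ> ext) ` ?X \<subseteq> {w. length w = l}"
    using code ext by (auto simp: index_code_def)
  ultimately have "card ?X \<le> card {w :: bool list. length w = l}"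
    by (rule card_inj_on_le[OF _ _ finite_lists_length])
  then have "(2::nat) ^ (card S * F) \<le> 2 ^ l"
    by (simp add: card_PiE fin card_lists_length power_mult[symmetric] mult.commute)
  then show ?thesis by simp
qed

text \<open>The colouring yields rates \<open>card S * (F + c) / F\<close>, which tend to
  \<open>card S\<close>; the decoding order on \<open>S\<close> shows that no rate is
  smaller.\<close>

theorem optimal_rate_eq_card:
  fixes col r :: "'f \<Rightarrow> nat" and P :: "('u, 'f) icp"
  assumes P: "valid_icp P"
    and card: "\<And>k. k \<in> users P \<Longrightarrow> card (col ` (files P - knows P k)) \<le> card S"
    and uniq: "\<And>k f g. k \<in> users P \<Longrightarrow> f \<in> wants P k \<Longrightarrow> g \<in> files P \<Longrightarrow> g \<notin> knows P k \<Longrightarrow>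
      col g = col f \<Longrightarrow> g = f"
    and S: "S \<subseteq> files P"
    and u: "\<And>f. f \<in> S \<Longrightarrow> u f \<in> users P \<and> f \<in> wants P (u f)"
    and r: "\<And>f g. f \<in> S \<Longrightarrow> g \<in> S \<Longrightarrow> g \<in> knows P (u f) \<Longrightarrow> r g < r f"
  shows "optimal_rate P = card S"
proof -
  let ?n = "card S"
  let ?A = "{real l / real F | l F. F \<ge> 1 \<and> (\<exists>enc dec. index_code P F l enc dec)}"
  obtain c where c: "\<And>F. \<exists>enc dec. index_code P F (?n * (F + c)) enc dec"
    using index_code_of_colouring[where P = P and col = col and n = ?n] P card uniq by metis
  have A: "real (?n * (F + c)) / real F \<in> ?A" if "F \<ge> 1" for F
    using c that by blast
  have low: "real ?n \<le> y" if y: "y \<in> ?A" for y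
  proof -
    obtain l F enc dec where lF: "y = real l / real F" "F \<ge> 1" "index_code P F l enc dec"
      using y by blast
    have "?n * F \<le> l"
      using P lF(3) S u r by (rule card_le_of_index_code[where u = u and r = r])
    then have "real ?n * real F \<le> real l" unfolding of_nat_mult[symmetric] of_nat_le_iff .
    then show ?thesis using lF by (simp add: pos_le_divide_eq)
  qed
  then have bdd: "bdd_below ?A" by (rule bdd_belowI)
  have "(\<lambda>F. real ?n + real ?n * real c / real F) \<longlonglongrightarrow> real ?n + 0"
    by (intro tendsto_add tendsto_const lim_const_over_n)
  moreover have "Inf ?A \<le> real ?n + real ?n * real c / real F" if "F \<ge> 1" for F
    using cInf_lower[OF A[OF that] bdd] that by (simp add: field_simps)
  ultimately have "Inf ?A \<le> real ?n"
    by (intro LIMSEQ_le_const[where X = "\<lambda>F. real ?n + real ?n * real c / real F"]) auto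
  moreover have "real ?n \<le> Inf ?A"
    using A[of 1] low by (intro cInf_greatest) auto
  ultimately show ?thesis by (simp add: optimal_rate_def)
qed

section \<open>Side-information expressed through offsets and colours\<close>

definition shift :: "nat \<Rightarrow> (nat \<Rightarrow> nat) \<Rightarrow> nat \<Rightarrow> nat"
  where "shift L a t = (\<Sum>j=1..<t. a j + L)"

text \<open>Walking back \<open>v\<close> steps from index \<open>t\<close> telescopes in
  \<open>shift\<close>. Passing from index \<open>1\<close> to index \<open>i\<close> adds one full
  turn, the sum of all \<open>a j + L\<close>.\<close>

lemma sum_cyc:
  assumes "t \<in> {1..i}" and "v < i"
  shows "(\<Sum>j=1..v. a \<langle>i + t - j\<rangle>\<^sub>i) + v * L + shift L a (if v < t then t - v else i + t - v) =
    shift L a t + (if v < t then 0 else (\<Sum>j=1..i. a j) + i * L)"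
  using assms(2)
proof (induction v)
  case 0
  then show ?case using assms by simp
next
  case (Suc v)
  have shift_Suc: "shift L a (Suc m) = shift L a m + a m + L" if "m \<ge> 1" for m
    using that by (simp add: shift_def)
  have total: "shift L a (Suc i) = (\<Sum>j=1..i. a j) + i * L"
    by (simp add: shift_def sum.distrib atLeastLessThanSuc_atLeastAtMost)
  consider "Suc v < t" | "Suc v = t" | "t < Suc v" by linarith
  then show ?case
  proof cases
    case 1
    have "i + t - Suc v = (t - Suc v) + i" using 1 by simp
    moreover have "0 < t - Suc v" "t - Suc v < i" using 1 assms by auto
    ultimately have "\<langle>i + t - Suc v\<rangle>\<^sub>i = t - Suc v"
      by (simp only: cyc_def mod_add_self2) simp
    moreover have "shift L a (t - v) = shift L a (t - Suc v) + a (t - Suc v) + L"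
      using shift_Suc[of "t - Suc v"] 1 by (simp add: Suc_diff_Suc)
    ultimately show ?thesis using Suc 1 by simp
  next
    \<comment> \<open>The wrap-around: the walk stands at index \<open>1\<close>, where
      \<open>shift\<close> is \<open>0\<close>, and the next step reaches index
      \<open>i\<close>.\<close>
    case 2
    then have "\<langle>i + t - Suc v\<rangle>\<^sub>i = i" by (simp add: cyc_def)
    moreover have "shift L a (t - v) = 0" using 2 by (simp add: shift_def)
    ultimately show ?thesis
      using Suc assms shift_Suc[of i] total by (simp add: ac_simps flip: 2)
  next
    case 3
    then have "\<langle>i + t - Suc v\<rangle>\<^sub>i = i + t - Suc v"
      using assms Suc.prems by (simp add: cyc_def)
    moreover have "shift L a (i + t - v) = shift L a (i + t - Suc v) + a (i + t - Suc v) + L"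
      using shift_Suc[of "i + t - Suc v"] 3 Suc.prems by (simp add: Suc_diff_Suc)
    ultimately show ?thesis using Suc 3 by simp
  qed
qed

text \<open>A full turn of \<open>shift\<close> equals \<open>num_users i L a - 1 + L\<close>. The
  excess over the modulus is what makes the wrapped case differ from the other one modulo the number
  of users.\<close>

lemma cyc_offset:
  assumes t: "t \<in> {1..i}" and v: "v \<in> {1..i - 1}"
  shows "int ((\<Sum>j=1..v. a \<langle>i + t - j\<rangle>\<^sub>i) + (v - 1) * L + r) =
    (if v < t then int (shift L a t) - int (shift L a (t - v)) - int L + int r
     else int (shift L a t) - int (shift L a (i + t - v)) + int (num_users i L a) - 1 + int r)"
proof -
  have "(v - 1) * L + L = v * L" "(i - 1) * L + L = i * L"
    using v by (cases v; cases i; auto)+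
  moreover have "(\<Sum>j=1..v. a \<langle>i + t - j\<rangle>\<^sub>i) + v * L + shift L a (if v < t then t - v else i + t - v) =
      shift L a t + (if v < t then 0 else (\<Sum>j=1..i. a j) + i * L)"
    using v by (intro sum_cyc[OF t]) auto
  ultimately show ?thesis
    by (cases "v < t") (simp_all add: num_users_def flip: of_nat_add of_nat_mult)
qed

text \<open>The index \<open>s\<close> is the one reached from \<open>t\<close> after
  \<open>v\<close> backward steps. In terms of residues, a user knows a window of length
  \<open>L\<close> ending at its own file of index \<open>s\<close> if \<open>s < t\<close>, and
  starting there if \<open>t < s\<close>. The position \<open>r\<close> in the window becomes
  \<open>e = L - r\<close> or \<open>e = r - 1\<close>.\<close>

lemma mem_knows_cyclic_icp_iff:
  "(b, t) \<in> knows (cyclic_icp i L a) k \<longleftrightarrow>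
    b \<in> {1..num_users i L a} \<and> t \<in> {1..i} \<and>
    (\<exists>s\<in>{1..i}. \<exists>e<L.
      s < t \<and> [int b - int (shift L a t) = int k - int (shift L a s) - int e] (mod num_users i L a) \<or>
      t < s \<and> [int b - int (shift L a t) = int k - int (shift L a s) + int e] (mod num_users i L a))"
    (is "_ \<longleftrightarrow> ?b \<and> ?t \<and> ?E")
proof -
  define K where "K = num_users i L a"
  define p where "p t = int (shift L a t)" for t
  define off where "off t v r = (\<Sum>j=1..v. a \<langle>i + t - j\<rangle>\<^sub>i) + (v - 1) * L + r" for t v r
  have K: "K \<ge> 1" by (simp add: K_def num_users_def)
  have off: "int (off t v r) = (if v < t then p t - p (t - v) - int L + int r
      else p t - p (i + t - v) + int K - 1 + int r)" if "t \<in> {1..i}" "v \<in> {1..i - 1}" for v r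
    unfolding off_def p_def K_def by (rule cyc_offset[OF that])
  have "knows (cyclic_icp i L a) k =
      {(\<langle>k + off t v r\<rangle>\<^sub>K, t) | t v r. t \<in> {1..i} \<and> v \<in> {1..i - 1} \<and> r \<in> {1..L}}"
    by (simp add: cyclic_icp_def Let_def K_def off_def add.assoc)
  then have "(b, t) \<in> knows (cyclic_icp i L a) k \<longleftrightarrow>
      ?t \<and> (\<exists>v\<in>{1..i - 1}. \<exists>r\<in>{1..L}. b = \<langle>k + off t v r\<rangle>\<^sub>K)"
    by blast
  also have "\<dots> \<longleftrightarrow> ?b \<and> ?t \<and> (\<exists>v\<in>{1..i - 1}. \<exists>r\<in>{1..L}. [int b = int k + int (off t v r)] (mod int K))"
    unfolding cyc_iff[OF K] K_def[symmetric]
    by (auto simp flip: cong_int_iff)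
  also have "\<dots> \<longleftrightarrow> ?b \<and> ?t \<and> ?E"
  proof (intro conj_cong refl iffI)
    assume t: ?t and "\<exists>v\<in>{1..i - 1}. \<exists>r\<in>{1..L}. [int b = int k + int (off t v r)] (mod int K)"
    then obtain v r where v: "v \<in> {1..i - 1}" and r: "r \<in> {1..L}"
      and b: "int K dvd int b - (int k + int (off t v r))"
      by (auto simp: cong_iff_dvd_diff)
    show ?E
    proof (cases "v < t")
      case True
      then have "[int b - p t = int k - p (t - v) - int (L - r)] (mod int K)"
        using b r off[OF t v] by (simp add: cong_iff_dvd_diff algebra_simps)
      then show ?thesis
        using True t v r unfolding K_def p_def
        by (intro bexI[of _ "t - v"] exI[of _ "L - r"]) auto
    next
      case False
      \<comment> \<open>Adding \<open>K\<close> cancels the full turn in the wrapped offset.\<close>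
      have "int K dvd int b - (int k + int (off t v r)) + int K"
        using b by simp
      then have "[int b - p t = int k - p (i + t - v) + int (r - 1)] (mod int K)"
        using False r off[OF t v] by (simp add: cong_iff_dvd_diff algebra_simps)
      then show ?thesis
        using False t v r unfolding K_def p_def
        by (intro bexI[of _ "i + t - v"] exI[of _ "r - 1"]) auto
    qed
  next
    assume t: ?t and ?E
    then obtain s e where s: "s \<in> {1..i}" and e: "e < L" and "
      s < t \<and> int K dvd (int b - p t) - (int k - p s - int e) \<or>
      t < s \<and> int K dvd (int b - p t) - (int k - p s + int e)"
      unfolding K_def p_def cong_iff_dvd_diff by blast
    then consider "s < t" "int K dvd (int b - p t) - (int k - p s - int e)"
      | "t < s" "int K dvd (int b - p t) - (int k - p s + int e)" by blast
    then show "\<exists>v\<in>{1..i - 1}. \<exists>r\<in>{1..L}. [int b = int k + int (off t v r)] (mod int K)"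
    proof cases
      case 1
      then have v: "t - s \<in> {1..i - 1}" using s t by auto
      have off_eq: "int (off t (t - s) (L - e)) = p t - p s - int e"
        using 1 s e off[OF t v, of "L - e"] by simp
      have "[int b = int k + int (off t (t - s) (L - e))] (mod int K)"
        unfolding off_eq cong_iff_dvd_diff using 1 by (simp add: algebra_simps)
      then show ?thesis using v e by (intro bexI[of _ "t - s"] bexI[of _ "L - e"]) auto
    next
      case 2
      then have v: "i + t - s \<in> {1..i - 1}" using s t by auto
      have "int K dvd (int b - p t) - (int k - p s + int e) - int K"
        using 2 by simp
      then have "[int b = int k + int (off t (i + t - s) (Suc e))] (mod int K)"
        using 2 s e off[OF t v] by (simp add: cong_iff_dvd_diff algebra_simps)
      then show ?thesis using v e by (intro bexI[of _ "i + t - s"] bexI[of _ "Suc e"]) auto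
    qed
  qed
  finally show ?thesis .
qed

definition colour :: "nat \<Rightarrow> nat \<Rightarrow> (nat \<Rightarrow> nat) \<Rightarrow> nat \<times> nat \<Rightarrow> nat"
  where "colour i L a = (\<lambda>(b, t). nat ((int b - int (shift L a t)) mod int (num_users i L a)))"

lemma num_users_pos: "num_users i L a > 0"
  by (simp add: num_users_def)

lemma colour_eq_iff:
  "colour i L a (b, t) = colour i L a (b', t') \<longleftrightarrow>
    [int b - int (shift L a t) = int b' - int (shift L a t')] (mod num_users i L a)"
  by (simp add: colour_def cong_def eq_nat_nat_iff num_users_pos)

lemma colour_less: "colour i L a f < num_users i L a"
  by (cases f) (simp add: colour_def num_users_pos nat_less_iff)

lemma cong_user_imp_eq:
  assumes "[int b = int b'] (mod int K)" and "b \<in> {1..K}" and "b' \<in> {1..K}"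
  shows "b = b'"
proof -
  have "int K dvd int b - int b'" using assms(1) by (simp add: cong_iff_dvd_diff)
  then show ?thesis
    using assms(2,3) dvd_imp_le_int[of "int b - int b'" "int K"] by fastforce
qed

lemma simps_cyclic_icp:
  "users (cyclic_icp i L a) = {1..num_users i L a}"
  "files (cyclic_icp i L a) = {1..num_users i L a} \<times> {1..i}"
  "wants (cyclic_icp i L a) k = {k} \<times> {1..i}"
  by (auto simp: cyclic_icp_def Let_def)

lemma colour_same_index_imp_eq:
  assumes "colour i L a (b, t) = colour i L a (b', t)"
    and "b \<in> {1..num_users i L a}" and "b' \<in> {1..num_users i L a}"
  shows "b = b'"
  using assms by (intro cong_user_imp_eq[OF _ assms(2,3)]) (auto simp: colour_eq_iff cong_iff_dvd_diff)

lemma not_knows_own: "t \<in> {1..i} \<Longrightarrow> k \<in> {1..num_users i L a} \<Longrightarrow> (k, t) \<notin> knows (cyclic_icp i L a) k"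
  using valid_cyclic_icp[of i L a] unfolding valid_icp_def simps_cyclic_icp by blast

section \<open>Part (1): all unknown files in a single gap\<close>

theorem optimal_rate_cyclic_icp_concentrated:
  assumes i: "i \<ge> 1" and L: "L \<ge> 1"
  shows "optimal_rate (cyclic_icp i L (\<lambda>j. if j = i then A else 0)) = i + A"
proof -
  define a where "a = (\<lambda>j. if j = i then A else 0)"
  define K where "K = num_users i L a"
  have K: "K = 1 + (i - 1) * L + A"
    using i by (simp add: K_def num_users_def a_def)
  have shift: "shift L a t = (t - 1) * L" if "t \<in> {1..i}" for t
    using that by (simp add: shift_def a_def)
  have shift_le: "(t - 1) * L \<le> (i - 1) * L" if "t \<in> {1..i}" for t
    using that by (intro mult_le_mono1) auto
  \<comment> \<open>Here \<open>m\<close> is how far the colour lies below \<open>k\<close>. The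
    windows for \<open>s < t\<close> cover all \<open>m < (t - 1) * L\<close>, those for
    \<open>s > t\<close> cover everything above \<open>(t - 1) * L\<close> up to
    \<open>(i - 1) * L\<close>; the values listed are what remains.\<close>
  have unknown: "\<exists>m<K. [int b - int ((t - 1) * L) = int k - int m] (mod K) \<and>
      (m = (t - 1) * L \<or> (i - 1) * L < m)"
    if b: "b \<in> {1..K}" and t: "t \<in> {1..i}" and un: "(b, t) \<notin> knows (cyclic_icp i L a) k" for b t k
  proof -
    define m where "m = nat ((int k - (int b - int ((t - 1) * L))) mod int K)"
    have m: "m < K" "[int b - int ((t - 1) * L) = int k - int m] (mod K)"
      using num_users_pos[of i L a]
      by (simp_all add: m_def nat_less_iff cong_def mod_diff_right_eq flip: K_def)
    have un': False
      if "s \<in> {1..i}" "e < L" "s < t \<and> int m = int ((s - 1) * L) + int e \<or>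
        t < s \<and> int m = int ((s - 1) * L) - int e" for s e
    proof -
      have "s < t \<and> int k - int m = int k - int (shift L a s) - int e \<or>
          t < s \<and> int k - int m = int k - int (shift L a s) + int e"
        using that(3) shift[OF that(1)] by linarith
      then have "(b, t) \<in> knows (cyclic_icp i L a) k"
        using m(2) b t that(1,2) unfolding mem_knows_cyclic_icp_iff K_def[symmetric] shift[OF t]
        by metis
      with un show False ..
    qed
    have "m = (t - 1) * L \<or> (i - 1) * L < m"
    proof (rule ccontr)
      assume "\<not> ?thesis"
      then consider "m < (t - 1) * L" | "(t - 1) * L < m" "m \<le> (i - 1) * L" by linarith
      then show False
      proof cases
        case 1
        then have "m div L < t - 1" by (simp add: less_mult_imp_div_less)
        then have "m div L + 1 < t" "m div L + 1 \<in> {1..i}" using t by auto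
        moreover have "int m = int (m div L * L) + int (m mod L)"
          by (simp only: of_nat_add[symmetric] div_mult_mod_eq)
        ultimately show False
          using un'[of "m div L + 1" "m mod L"] L by simp
      next
        case 2
        \<comment> \<open>Dividing \<open>m - 1\<close> instead of \<open>m\<close> fits windows
          that end at a multiple of \<open>L\<close>: \<open>m = (q + 1) * L - (L - 1 - r)\<close>,
          so \<open>s = q + 2\<close>.\<close>
        define q r where "q = (m - 1) div L" and "r = (m - 1) mod L"
        have "r < L" using L by (simp add: r_def)
        have "t - 1 \<le> q"
          using 2 L by (simp add: q_def less_eq_div_iff_mult_less_eq)
        then have "t < q + 2" by simp
        moreover have "q < i - 1"
          unfolding q_def using 2 by (intro less_mult_imp_div_less) auto
        then have "q + 2 \<in> {1..i}" by simp
        moreover have "m = q * L + r + 1"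
          using 2 by (simp add: q_def r_def)
        then have "int m = int ((q + 1) * L) - int (L - 1 - r)"
          using \<open>r < L\<close> by (simp add: algebra_simps)
        ultimately show False
          using un'[of "q + 2" "L - 1 - r"] L by simp
      qed
    qed
    with m show ?thesis by blast
  qed
  define S where "S = {1} \<times> {1..i} \<union> {2..Suc A} \<times> {1 :: nat}"
  have "optimal_rate (cyclic_icp i L a) = card S"
  proof (rule optimal_rate_eq_card[where col = "colour i L a" and u = fst and r = fst])
    fix k assume "k \<in> users (cyclic_icp i L a)"
    \<comment> \<open>The distances possible for unknown files: at most \<open>i\<close> multiples
      of \<open>L\<close>, and \<open>K - 1 - (i - 1) * L = A\<close> further values.\<close>
    let ?V = "(\<lambda>t. (t - 1) * L) ` {1..i} \<union> {(i - 1) * L<..<K}"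
    have "colour i L a ` (files (cyclic_icp i L a) - knows (cyclic_icp i L a) k)
      \<subseteq> (\<lambda>m. nat ((int k - int m) mod int K)) ` ?V"
    proof (rule image_subsetI)
      fix f assume f: "f \<in> files (cyclic_icp i L a) - knows (cyclic_icp i L a) k"
      then obtain b t where f_eq: "f = (b, t)" and bt: "b \<in> {1..K}" "t \<in> {1..i}"
        by (auto simp: simps_cyclic_icp K_def)
      then obtain m where m: "m < K" "[int b - int ((t - 1) * L) = int k - int m] (mod K)"
          "m = (t - 1) * L \<or> (i - 1) * L < m"
        using unknown[of b t k] f by auto
      then have "colour i L a f = nat ((int k - int m) mod int K)"
        using shift[of t] bt by (simp add: f_eq colour_def cong_def flip: K_def)
      moreover have "m \<in> ?V" using m bt by auto
      ultimately show "colour i L a f \<in> (\<lambda>m. nat ((int k - int m) mod int K)) ` ?V"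
        by blast
    qed
    then have "card (colour i L a ` (files (cyclic_icp i L a) - knows (cyclic_icp i L a) k)) \<le> card ?V"
      by (rule surj_card_le[rotated]) simp
    also have "\<dots> \<le> card {1..i} + card {(i - 1) * L<..<K}"
      by (intro order_trans[OF card_Un_le] add_right_mono card_image_le) simp
    also have "\<dots> = i + A" using K by simp
    also have "\<dots> = card S"
      unfolding S_def by (subst card_Un_disjoint) (auto simp: card_cartesian_product)
    finally show "card (colour i L a ` (files (cyclic_icp i L a) - knows (cyclic_icp i L a) k)) \<le> card S" .
  next
    fix k f g
    assume k: "k \<in> users (cyclic_icp i L a)" and f: "f \<in> wants (cyclic_icp i L a) k"
      and g: "g \<in> files (cyclic_icp i L a)" "g \<notin> knows (cyclic_icp i L a) k"
      and col: "colour i L a g = colour i L a f"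
    obtain t b t' where f_eq: "f = (k, t)" and t: "t \<in> {1..i}" and g_eq: "g = (b, t')"
      and b: "b \<in> {1..K}" and t': "t' \<in> {1..i}"
      using f g by (auto simp: simps_cyclic_icp K_def)
    obtain m where m: "m < K" "[int b - int ((t' - 1) * L) = int k - int m] (mod K)"
        "m = (t' - 1) * L \<or> (i - 1) * L < m"
      using unknown[OF b t'] g g_eq by blast
    have "[int b - int ((t' - 1) * L) = int k - int ((t - 1) * L)] (mod K)"
      using col unfolding f_eq g_eq colour_eq_iff shift[OF t] shift[OF t'] K_def .
    then have "[int k - int m = int k - int ((t - 1) * L)] (mod K)"
      using m(2) by (metis cong_sym cong_trans)
    then have "[int ((t - 1) * L) = int m] (mod int K)"
      by (simp add: cong_iff_dvd_diff)
    moreover have "(t - 1) * L < K" using shift_le[OF t] K by linarith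
    ultimately have "m = (t - 1) * L"
      using m(1) unfolding cong_int_iff by (simp add: cong_def)
    \<comment> \<open>The own file has distance \<open>(t - 1) * L\<close>, at most
      \<open>(i - 1) * L\<close>, which excludes the second alternative for
      \<open>m\<close>.\<close>
    then have "(t - 1) * L = (t' - 1) * L"
      using m(3) shift_le[OF t] by auto
    then have "t = t'" using L t t' by auto
    moreover have "b = k"
      using colour_same_index_imp_eq[of i L a b t' k] col b k \<open>t = t'\<close>
      by (auto simp: f_eq g_eq K_def simps_cyclic_icp)
    ultimately show "g = f" by (simp add: f_eq g_eq)
  next
    fix f g assume f: "f \<in> S" and g: "g \<in> S" and "g \<in> knows (cyclic_icp i L a) (fst f)"
    then obtain b b' t' where b: "b = fst f" and g_eq: "g = (b', t')"
      and kn: "(b', t') \<in> knows (cyclic_icp i L a) b" by (cases g) auto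
    have range: "b \<in> {1..Suc A}" "b' \<in> {1..Suc A}" "t' \<in> {1..i}"
      using f g i by (auto simp: S_def b g_eq)
    \<comment> \<open>Otherwise \<open>b' > 1\<close>, so \<open>t' = 1\<close> and only windows
      with \<open>s > 1\<close> can contain the file. The number that \<open>K\<close> would have to
      divide then lies strictly between \<open>0\<close> and \<open>K\<close>.\<close>
    have "b' \<le> b"
    proof (rule ccontr)
      assume "\<not> b' \<le> b"
      then have "t' = 1" using g range by (auto simp: S_def g_eq)
      then obtain s e where s: "s \<in> {1..i}" "1 < s" and e: "e < L"
        and "[int b' = int b - int ((s - 1) * L) + int e] (mod K)"
        using kn shift unfolding mem_knows_cyclic_icp_iff K_def[symmetric] by force
      then have "int K dvd int b' - int b + int ((s - 1) * L) - int e"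
        by (simp add: cong_iff_dvd_diff algebra_simps)
      moreover have "1 * L \<le> (s - 1) * L" using s by (intro mult_le_mono1) simp
      then have "int b' - int b + int ((s - 1) * L) - int e > 0"
        using \<open>\<not> b' \<le> b\<close> e by linarith
      moreover have "b' + (s - 1) * L < b + K"
        using K shift_le[OF s(1)] range unfolding atLeastAtMost_iff by linarith
      then have "int b' - int b + int ((s - 1) * L) - int e < int K"
        by linarith
      ultimately show False by (simp add: zdvd_not_zless)
    qed
    moreover have "b' \<noteq> b"
      using not_knows_own[of t' i b L a] kn range K by (auto simp: K_def)
    ultimately show "fst g < fst f" by (simp add: b g_eq)
  qed (use i K in \<open>auto simp: S_def simps_cyclic_icp valid_cyclic_icp simp flip: K_def\<close>)
  moreover have "card S = i + A"
    unfolding S_def by (subst card_Un_disjoint) (auto simp: card_cartesian_product)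
  ultimately show ?thesis by (simp add: a_def)
qed

section \<open>Part (2): windows of length one\<close>

theorem optimal_rate_cyclic_icp_one:
  assumes i: "i \<ge> 1"
  shows "optimal_rate (cyclic_icp i 1 a) = num_users i 1 a"
proof -
  define K where "K = num_users i 1 a"
  let ?P = "cyclic_icp i 1 a" and ?col = "colour i 1 a"
  have shift_mono: "shift 1 a s < shift 1 a t" if "1 \<le> s" "s < t" for s t
  proof -
    have "shift 1 a t = shift 1 a s + (\<Sum>j=s..<t. a j + 1)"
      unfolding shift_def using that by (intro sum.atLeastLessThan_concat[symmetric]) auto
    moreover have "(\<Sum>j=s..<t. a j + 1) > 0"
      using that by (intro sum_pos) auto
    ultimately show ?thesis by simp
  qed
  have "shift 1 a (Suc i) = K"
    using i by (simp add: shift_def K_def num_users_def atLeastLessThanSuc_atLeastAtMost sum_Suc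
      del: sum.op_ivl_Suc)
  then have shift_less: "shift 1 a t < K" if "t \<in> {1..i}" for t
    using shift_mono[of t "Suc i"] that by simp
  \<comment> \<open>The offsets increase strictly and stay below \<open>K\<close>, so the files of
    one user have distinct colours.\<close>
  have index_eq: "t = t'" if "?col (b, t) = ?col (b, t')" "t \<in> {1..i}" "t' \<in> {1..i}" for b t t'
  proof -
    have "[int (shift 1 a t') = int (shift 1 a t)] (mod int K)"
      using that(1) unfolding colour_eq_iff K_def[symmetric] by (simp add: cong_iff_dvd_diff)
    then have "shift 1 a t' = shift 1 a t"
      using shift_less that unfolding cong_int_iff by (simp add: cong_def)
    then show ?thesis
      using shift_mono[of t t'] shift_mono[of t' t] that by (cases t t' rule: linorder_cases) auto
  qed
  \<comment> \<open>With \<open>L = 1\<close> only \<open>e = 0\<close> remains, and both windows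
    shrink to the colour of the user's own file of index \<open>s\<close>.\<close>
  have knows: "(b, t) \<in> knows ?P k \<longleftrightarrow>
      b \<in> {1..K} \<and> t \<in> {1..i} \<and> (\<exists>s\<in>{1..i} - {t}. ?col (b, t) = ?col (k, s))" for b t k
    unfolding mem_knows_cyclic_icp_iff colour_eq_iff K_def[symmetric]
    by (auto simp: neq_iff)
  define S where "S = {f \<in> files ?P. \<forall>g\<in>files ?P. ?col g = ?col f \<longrightarrow> fst f \<le> fst g}"
  have "inj_on ?col S"
  proof (rule inj_onI)
    fix f g assume "f \<in> S" "g \<in> S" "?col f = ?col g"
    moreover from this have "fst f = fst g"
      by (intro order_antisym) (auto simp: S_def)
    ultimately show "f = g"
      using index_eq by (cases f; cases g) (auto simp: S_def simps_cyclic_icp)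
  qed
  moreover have "?col ` S = {..<K}"
  proof (intro equalityI subsetI)
    fix c assume c: "c \<in> {..<K}"
    \<comment> \<open>Index \<open>1\<close> has offset \<open>0\<close>, so its files show every
      residue; users are numbered from \<open>1\<close>, hence \<open>K\<close> stands for residue
      \<open>0\<close>.\<close>
    have "?col (if c = 0 then K else c, 1) = c" "(if c = 0 then K else c, 1) \<in> files ?P"
      using c i by (auto simp: colour_def shift_def simps_cyclic_icp simp flip: K_def[unfolded One_nat_def])
    then obtain f where "f \<in> files ?P \<and> ?col f = c"
        "\<forall>g. g \<in> files ?P \<and> ?col g = c \<longrightarrow> fst f \<le> fst g"
      using ex_has_least_nat[of "\<lambda>f. f \<in> files ?P \<and> ?col f = c" _ fst] by blast
    then show "c \<in> ?col ` S" by (intro image_eqI[of _ _ f]) (auto simp: S_def)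
  qed (auto simp: K_def colour_less)
  ultimately have card_S: "card S = K" by (metis card_image card_lessThan)
  have "optimal_rate ?P = card S"
  proof (rule optimal_rate_eq_card[where col = "?col" and u = fst and r = fst])
    fix k
    show "card (?col ` (files ?P - knows ?P k)) \<le> card S"
      unfolding card_S using card_mono[of "{..<K}"] by (auto simp: K_def colour_less image_subset_iff)
  next
    fix k f g
    assume k: "k \<in> users ?P" and f: "f \<in> wants ?P k"
      and g: "g \<in> files ?P" "g \<notin> knows ?P k" and col: "?col g = ?col f"
    obtain t b t' where "f = (k, t)" "t \<in> {1..i}" "g = (b, t')" "b \<in> {1..K}" "t' \<in> {1..i}"
      using f g by (auto simp: simps_cyclic_icp K_def)
    \<comment> \<open>With distinct indices, sharing the colour of an own file would make
      \<open>g\<close> known.\<close>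
    moreover from this have "t = t'" using g col knows[of b t' k] by auto
    ultimately show "g = f"
      using colour_same_index_imp_eq[of i 1 a b t k] col k
      by (auto simp: K_def simps_cyclic_icp)
  next
    fix f g assume f: "f \<in> S" and g: "g \<in> S" and kn: "g \<in> knows ?P (fst f)"
    obtain b t b' t' where eq: "f = (b, t)" "g = (b', t')" by (cases f; cases g) auto
    then have "(b', t') \<in> knows ?P b" using kn by simp
    \<comment> \<open>A known file shares its colour with an own file of user \<open>b\<close>, so
      minimality of \<open>b'\<close> in that class gives \<open>b' \<le> b\<close>.\<close>
    then obtain s where s: "s \<in> {1..i}" "?col (b', t') = ?col (b, s)"
      using knows[of b' t' b] by blast
    have "(b, s) \<in> files ?P" using f s by (auto simp: S_def eq simps_cyclic_icp)
    then have "b' \<le> b" using g s by (auto simp: S_def eq)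
    moreover have "b' \<noteq> b"
      using not_knows_own[of t' i b 1 a] kn f g by (auto simp: eq S_def simps_cyclic_icp)
    ultimately show "fst g < fst f" by (simp add: eq)
  qed (auto simp: S_def simps_cyclic_icp valid_cyclic_icp)
  then show ?thesis by (simp add: card_S K_def)
qed

theorem corollary4:
  fixes i L :: nat
  assumes "i \<ge> 1" and "L \<ge> 1"
  shows "(\<forall>(a_i::nat) (K::nat). K = 1 + (i - 1) * L + a_i \<longrightarrow>
           optimal_rate (cyclic_icp i L (\<lambda>j. if j = i then a_i else 0)) =
             real K - (real i - 1) * real L + real i - 1)
       \<and> (\<forall>(a::nat \<Rightarrow> nat) (K::nat). K = 1 + (i - 1) + (\<Sum>j=1..i. a j) \<longrightarrow>
           optimal_rate (cyclic_icp i 1 a) = real K)"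
  using assms
  by (auto simp: optimal_rate_cyclic_icp_concentrated optimal_rate_cyclic_icp_one[unfolded One_nat_def]
      num_users_def)

end
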